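(* Let $k\ge 1$, $n\geq 1$, let $\Omega\subset\mathbb{R}^2$ be open and convex, and let $A\in C^k(\Omega,\mathbb{C}^{n\times n})$ have distinct eigenvalues at every point of $\Omega$. Let $\Gamma\subset\Omega$ be a smooth Jordan curve, parametrized by $\gamma$ in such a way that both $\gamma(\cdot)$ and $A(\gamma(\cdot))$ are $1$-periodic. Let $A(\gamma(t))=V(t)\Lambda(t)V^{-1}(t)$, $t\in\mathbb{R}$, with $V=[v_1,\dots,v_n]$ and $\Lambda=\mathrm{diag}(\lambda_1,\dots,\lambda_n)$, be a $C^k$ parallel-transport eigendecomposition. Then there are constants $\alpha_1,\dots,\alpha_n\in\mathbb{R}$ such that, for all $j=1,\dots,n$ and all $t\in\mathbb{R}$: (i) $\lambda_j(t+1)=\lambda_j(t)$; (ii) $v_j(t+1)=e^{i\alpha_j}v_j(t)$; (iii) $\sum_{j=1}^n\alpha_j=0 \pmod{\pi}$.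
   Context: "$p$-periodic", when said of $\gamma(\cdot)$ and $A(\gamma(\cdot))$, means that $p$ is the minimal positive period. A smooth Jordan curve is a $C^1$, $1$-periodic map $\gamma:\mathbb{R}\to\mathbb{R}^2$ that is one-to-one on $[0,1)$; its image $\Gamma$ is also called a smooth Jordan curve. Parallel-transport eigendecomposition: for a matrix function $B(t)\in\mathbb{C}^{n\times n}$ with distinct eigenvalues for all $t$, a $C^k$ eigendecomposition is $B(t)=V(t)\Lambda(t)V^{-1}(t)$ with $V=[v_1,\dots,v_n]$ invertible, $\Lambda=\mathrm{diag}(\lambda_1,\dots,\lambda_n)$, and $V,\Lambda$ of class $C^k$. Put $P(t)=V^{-1}(t)\dot V(t)$. It is a parallel-transport eigendecomposition if for all $j$ and $t$: $\mathrm{Re}(v_j^*v_jP_{jj})=-\sum_{l\ne j}\mathrm{Re}(v_j^*v_lP_{lj})$ (equivalently, $\|v_j(t)\|$ is constant in $t$), and $\mathrm{Im}(P_{jj}(t))=0$. *)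

theory Defs
  imports "HOL-Analysis.Analysis" "HOL-Library.Real_Mod"
begin

text \<open>
  Class \<open>C\<^sup>k\<close> on an \<^emph>\<open>open\<close> set \<open>S\<close>, in the real sense: \<open>f\<close> is differentiable at every point of \<open>S\<close>
  and all its directional derivatives are of class \<open>C\<^sup>k\<^sup>-\<^sup>1\<close> there.  On a finite-dimensional domain
  this is the usual requirement that all partial derivatives up to order \<open>k\<close> exist and are continuous.
\<close>
primrec Ck_on :: "nat \<Rightarrow> ('a::real_normed_vector \<Rightarrow> 'b::real_normed_vector) \<Rightarrow> 'a set \<Rightarrow> bool" where
  "Ck_on 0 f S \<longleftrightarrow> continuous_on S f"
| "Ck_on (Suc k) f S \<longleftrightarrow>
     (\<forall>x\<in>S. f differentiable (at x)) \<and> (\<forall>v. Ck_on k (\<lambda>x. frechet_derivative f (at x) v) S)"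

definition minimal_period :: "real \<Rightarrow> (real \<Rightarrow> 'a) \<Rightarrow> bool" where
  "minimal_period p f \<longleftrightarrow>
     p > 0 \<and> (\<forall>t. f (t + p) = f t) \<and> (\<forall>q. 0 < q \<and> q < p \<longrightarrow> \<not> (\<forall>t. f (t + q) = f t))"

definition smooth_Jordan_curve :: "(real \<Rightarrow> real^2) \<Rightarrow> bool" where
  "smooth_Jordan_curve \<gamma> \<longleftrightarrow>
     \<gamma> C1_differentiable_on UNIV \<and> minimal_period 1 \<gamma> \<and> inj_on \<gamma> {0..<1}"

definition eigenvalues :: "complex^'n^'n \<Rightarrow> complex set" where
  "eigenvalues B = {\<mu>. \<exists>x. x \<noteq> 0 \<and> B *v x = \<mu> *s x}"

definition distinct_eigenvalues :: "complex^'n^'n \<Rightarrow> bool" where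
  "distinct_eigenvalues B \<longleftrightarrow> card (eigenvalues B) = CARD('n)"

definition diag :: "complex^'n \<Rightarrow> complex^'n^'n" where
  "diag d = (\<chi> i j. if i = j then d $ i else 0)"

text \<open>The product \<open>x\<^sup>* y\<close>; conjugation is on the first argument.\<close>
definition hprod :: "complex^'n \<Rightarrow> complex^'n \<Rightarrow> complex" where
  "hprod x y = (\<Sum>i\<in>UNIV. cnj (x $ i) * y $ i)"

text \<open>The diagonal of \<open>\<Lambda>(t)\<close> is given as a vector \<open>lam t\<close>; the eigenvectors are the columns of \<open>V t\<close>.\<close>
definition Ck_eigendecomposition ::
    "nat \<Rightarrow> (real \<Rightarrow> complex^'n^'n) \<Rightarrow> (real \<Rightarrow> complex^'n^'n) \<Rightarrow> (real \<Rightarrow> complex^'n) \<Rightarrow> bool" where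
  "Ck_eigendecomposition k B V lam \<longleftrightarrow>
     Ck_on k V UNIV \<and> Ck_on k (\<lambda>t. diag (lam t)) UNIV \<and>
     (\<forall>t. invertible (V t) \<and> B t = V t ** diag (lam t) ** matrix_inv (V t))"

definition transport_matrix :: "(real \<Rightarrow> complex^'n^'n) \<Rightarrow> real \<Rightarrow> complex^'n^'n" where
  "transport_matrix V t = matrix_inv (V t) ** vector_derivative V (at t)"

definition parallel_transport_eigendecomposition ::
    "nat \<Rightarrow> (real \<Rightarrow> complex^'n^'n) \<Rightarrow> (real \<Rightarrow> complex^'n^'n) \<Rightarrow> (real \<Rightarrow> complex^'n) \<Rightarrow> bool" where
  "parallel_transport_eigendecomposition k B V lam \<longleftrightarrow>
     Ck_eigendecomposition k B V lam \<and>
     (\<forall>j t. let P = transport_matrix V t; v = (\<lambda>l. column l (V t)) in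
        Re (hprod (v j) (v j) * P $ j $ j) = - (\<Sum>l\<in>UNIV - {j}. Re (hprod (v j) (v l) * P $ l $ j)) \<and>
        Im (P $ j $ j) = 0)"

end

theory Submission
  imports Defs
begin

text \<open>
  The spectrum of \<open>A\<close> is an \<open>n\<close>-sheeted covering of the convex, hence simply connected, set \<open>\<Omega>\<close>.
  The identity of \<open>\<Omega>\<close> therefore lifts to a continuous eigenvalue, and by uniqueness of lifts
  \<open>\<lambda>\<^sub>j\<close> is this function evaluated along \<open>\<gamma>\<close>; that gives (i).  Hence \<open>v\<^sub>j(t + 1) = c\<^sub>j(t) v\<^sub>j(t)\<close>.
  Constancy of \<open>\<parallel>v\<^sub>j\<parallel>\<close> forces \<open>\<bar>c\<^sub>j\<bar> = 1\<close>, while \<open>c\<^sub>j'/c\<^sub>j = P\<^sub>j\<^sub>j(t + 1) - P\<^sub>j\<^sub>j(t)\<close> is real, so that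
  \<open>c\<^sub>j\<close> is constant.  Finally \<open>W = det V\<close> satisfies \<open>W' = W tr P\<close> with \<open>tr P\<close> real, so \<open>W / cnj W\<close> is
  constant, and comparing \<open>t = 0\<close> with \<open>t = 1\<close> shows that \<open>\<Prod>c\<^sub>j\<close> is real.
\<close>

section \<open>Diagonalization and the characteristic polynomial\<close>

lemma diag_mult_vector: "diag d *v c = (\<chi> i. d $ i * c $ i)"
  by (simp add: vec_eq_iff diag_def matrix_vector_mult_def if_distrib if_distribR cong: if_cong)

lemma matrix_mult_diag: "column j (V ** diag d) = d $ j *s column j V"
  by (simp add: vec_eq_iff diag_def matrix_matrix_mult_def column_def if_distrib if_distribR mult.commute cong: if_cong)

lemma column_matrix_mult: "column j (A ** B) = A *v column j B"
  by (simp add: vec_eq_iff matrix_matrix_mult_def matrix_vector_mult_def column_def)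

lemma matrix_mult_axis: "A *v axis j 1 = column j A" for A :: "'a::comm_semiring_1^'n^'m"
  by (simp add: vec_eq_iff matrix_vector_mult_def axis_def column_def if_distrib cong: if_cong)

lemma matrix_eq_columns: "A = B \<longleftrightarrow> (\<forall>j. column j A = column j B)"
  by (auto simp: vec_eq_iff column_def)

lemma invertible_if_distinct_eigencolumns:
  fixes B V :: "complex^'n^'n"
  assumes BV: "B ** V = V ** diag d" and inj: "inj (($) d)" and nz: "\<And>j. column j V \<noteq> 0"
  shows "invertible V"
proof -
  txt \<open>The kernel of \<open>V\<close> is invariant under \<open>diag d\<close>, hence under the Lagrange polynomials in
    \<open>diag d\<close>, which project onto the coordinate axes.\<close>
  have step: "V *v (\<chi> i. (d $ i - s) * c $ i) = 0" if "V *v c = 0" for c s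
  proof -
    have "(\<chi> i. (d $ i - s) * c $ i) = diag d *v c - s *s c"
      by (simp add: vec_eq_iff diag_mult_vector algebra_simps)
    then have "V *v (\<chi> i. (d $ i - s) * c $ i) = V *v (diag d *v c) - s *s (V *v c)"
      by (simp add: matrix_vector_mult_diff_distrib vector_scalar_commute)
    also have "V *v (diag d *v c) = B *v (V *v c)"
      by (simp add: matrix_vector_mul_assoc BV)
    finally show ?thesis using that by simp
  qed
  have all: "V *v (\<chi> i. (\<Prod>s\<in>S. d $ i - s) * c $ i) = 0" if "V *v c = 0" "finite S" for c S
    using that(2)
  proof induction
    case empty
    then show ?case using that(1) by simp
  next
    case (insert s S)
    then show ?case using step[OF insert.IH, of s] by (simp add: mult.assoc)
  qed
  have "c = 0" if c: "V *v c = 0" for c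
  proof -
    have "c $ j = 0" for j
    proof -
      \<comment> \<open>The product over \<open>?S\<close> vanishes at every coordinate
        \<open>i \<noteq> j\<close>, because \<open>d $ i\<close> lies in \<open>?S\<close> by
        injectivity, and is nonzero at \<open>j\<close>.\<close>
      let ?S = "range (($) d) - {d $ j}"
      let ?w = "\<chi> i. (\<Prod>s\<in>?S. d $ i - s) * c $ i"
      have "?w $ i = 0" if "i \<noteq> j" for i
        using that injD[OF inj, of i j] by (auto simp: intro!: prod_zero bexI[of _ "d $ i"])
      then have "V *v ?w = ?w $ j *s column j V"
        by (subst matrix_mult_sum, subst sum.remove[of _ j])
          (auto intro!: sum.neutral simp del: vec_lambda_beta)
      with all[OF c, of ?S] nz[of j] have "?w $ j = 0"
        by auto
      then show ?thesis by auto
    qed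
    then show ?thesis by (simp add: vec_eq_iff)
  qed
  then show ?thesis
    unfolding invertible_left_inverse matrix_left_invertible_ker by blast
qed

text \<open>\<open>V\<close> intertwines \<open>mat z - B\<close> with the diagonal matrix of
  entries \<open>z - d $ i\<close>; taking determinants, the nonzero factor \<open>det V\<close>
  cancels.\<close>

lemma det_diagonalized:
  fixes B V :: "complex^'n^'n"
  assumes BV: "B ** V = V ** diag d" and V: "invertible V"
  shows "det (mat z - B) = (\<Prod>j\<in>UNIV. z - d $ j)"
proof -
  have "(mat z - B) ** V = V ** diag (\<chi> i. z - d $ i)"
  proof -
    have "column j ((mat z - B) ** V) = column j (V ** diag (\<chi> i. z - d $ i))" for j
    proof -
      have "column j ((mat z - B) ** V) = mat z *v column j V - column j (B ** V)"
        by (simp add: column_matrix_mult matrix_vector_mult_diff_rdistrib)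
      also have "mat z *v column j V = z *s column j V"
        by (simp add: vec_eq_iff matrix_vector_mult_def mat_def if_distrib if_distribR cong: if_cong)
      finally show ?thesis
        by (simp add: BV matrix_mult_diag vec_eq_iff algebra_simps)
    qed
    then show ?thesis by (simp add: matrix_eq_columns)
  qed
  then have "det (mat z - B) * det V = det V * det (diag (\<chi> i. z - d $ i))"
    by (metis det_mul)
  moreover have "det (diag (\<chi> i. z - d $ i)) = (\<Prod>j\<in>UNIV. z - d $ j)"
    by (subst det_diagonal) (auto simp: diag_def)
  ultimately show ?thesis using V by (simp add: invertible_det_nz)
qed

lemma eigenvalue_iff_det: "z \<in> eigenvalues B \<longleftrightarrow> det (mat z - B) = 0"
proof -
  have mat: "mat z *v x = z *s x" for x :: "complex^'n"
    by (simp add: vec_eq_iff matrix_vector_mult_def mat_def if_distrib if_distribR cong: if_cong)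
  then have "(mat z - B) *v x = 0 \<longleftrightarrow> B *v x = z *s x" for x
    unfolding matrix_vector_mult_diff_rdistrib mat by auto
  moreover have "det (mat z - B) = 0 \<longleftrightarrow> \<not> invertible (mat z - B)"
    by (simp add: invertible_det_nz)
  ultimately show ?thesis
    unfolding eigenvalues_def invertible_left_inverse matrix_left_invertible_ker by auto
qed

lemma eigenvalues_diagonalized:
  fixes B V :: "complex^'n^'n"
  assumes "B ** V = V ** diag d" "invertible V"
  shows "eigenvalues B = range (($) d)"
  by (auto simp: eigenvalue_iff_det det_diagonalized[OF assms])

lemma finite_eigenvalues: "distinct_eigenvalues B \<Longrightarrow> finite (eigenvalues B)"
  unfolding distinct_eigenvalues_def by (metis card.infinite zero_less_card_finite less_irrefl)

text \<open>Choosing one eigenvector per eigenvalue yields a matrix with distinct eigencolumns,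
  which is invertible and so diagonalizes \<open>B\<close>. The product then no longer depends on
  the numbering \<open>f\<close>.\<close>

lemma det_distinct_eigenvalues:
  fixes B :: "complex^'n^'n"
  assumes B: "distinct_eigenvalues B"
  shows "det (mat z - B) = (\<Prod>\<mu>\<in>eigenvalues B. z - \<mu>)"
proof -
  obtain f where f: "bij_betw f (UNIV :: 'n set) (eigenvalues B)"
    using B finite_eigenvalues[OF B] unfolding distinct_eigenvalues_def
    by (metis finite_same_card_bij finite)
  then have "\<forall>i. \<exists>x. x \<noteq> 0 \<and> B *v x = f i *s x"
    unfolding bij_betw_def eigenvalues_def by blast
  then obtain x where x: "\<And>i. x i \<noteq> 0" "\<And>i. B *v x i = f i *s x i"
    by metis
  define V d where "V = (\<chi> i j. x j $ i)" and "d = (\<chi> i. f i)"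
  have col: "column j V = x j" for j
    by (simp add: V_def column_def)
  have BV: "B ** V = V ** diag d"
    by (simp add: matrix_eq_columns matrix_mult_diag column_matrix_mult[of _ B] col x d_def)
  have "inj (($) d)"
    using f by (simp add: d_def bij_betw_def inj_on_def)
  then have "invertible V"
    using invertible_if_distinct_eigencolumns[OF BV] x col by simp
  from det_diagonalized[OF BV this] show ?thesis
    by (simp add: d_def prod.reindex_bij_betw[OF f, of "\<lambda>\<mu>. z - \<mu>"])
qed

section \<open>The spectrum as a covering space\<close>

text \<open>The modulus of the characteristic polynomial at \<open>z\<close> is the product of the
  \<open>n\<close> distances from \<open>z\<close> to the eigenvalues; if all were at least
  \<open>r\<close>, it would be at least \<open>r ^ n\<close>. This turns continuity of the
  determinant into continuity of the spectrum.\<close>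

lemma eigenvalue_near:
  fixes B :: "complex^'n^'n"
  assumes B: "distinct_eigenvalues B" and "0 \<le> r" and less: "norm (det (mat z - B)) < r ^ CARD('n)"
  shows "\<exists>\<mu>\<in>eigenvalues B. dist \<mu> z < r"
proof (rule ccontr)
  assume "\<not> ?thesis"
  then have "r \<le> norm (z - \<mu>)" if "\<mu> \<in> eigenvalues B" for \<mu>
    using that by (metis dist_norm dist_commute not_less)
  then have "(\<Prod>\<mu>\<in>eigenvalues B. r) \<le> (\<Prod>\<mu>\<in>eigenvalues B. norm (z - \<mu>))"
    using \<open>0 \<le> r\<close> by (intro prod_mono) auto
  then show False
    using less B by (simp add: det_distinct_eigenvalues prod_norm distinct_eigenvalues_def)
qed

lemma continuous_on_det_char:
  assumes "continuous_on S A"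
  shows "continuous_on S (\<lambda>x. det (mat z - A x :: complex^'n^'n))"
  unfolding det_def using assms by (intro continuous_intros) (auto intro!: continuous_intros)

text \<open>Disjoint discs are placed around the eigenvalues of \<open>A x\<close>. Over a
  neighbourhood \<open>T\<close> of \<open>x\<close>, each disc contains exactly one eigenvalue of
  \<open>A y\<close>, and this eigenvalue moves continuously with \<open>y\<close>. The sheets over
  \<open>T\<close> are the graphs of these functions.\<close>

lemma covering_space_eigenvalues:
  fixes A :: "'a::topological_space \<Rightarrow> complex^'n^'n"
  assumes contA: "continuous_on S A" and dist: "\<And>x. x \<in> S \<Longrightarrow> distinct_eigenvalues (A x)"
  shows "covering_space (SIGMA x:S. eigenvalues (A x)) fst S"
proof
  let ?C = "SIGMA x:S. eigenvalues (A x)"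
  show "continuous_on ?C fst"
    by (intro continuous_intros)
  have "eigenvalues (A x) \<noteq> {}" if "x \<in> S" for x
    using dist[OF that] by (auto simp: distinct_eigenvalues_def)
  then show "fst ` ?C = S" by force
  fix x assume x: "x \<in> S"
  define E where "E = eigenvalues (A x)"
  have finE: "finite E"
    using finite_eigenvalues dist x by (auto simp: E_def)
  then obtain e where e: "e > 0" "\<And>a b. a \<in> E \<Longrightarrow> b \<in> E \<Longrightarrow> dist a b < e \<Longrightarrow> a = b"
    using uniform_discrete_finite_iff[of E] unfolding uniform_discrete_def by metis
  \<comment> \<open>Half the separation of \<open>E\<close>, so that the discs of radius
    \<open>r\<close> around its points are disjoint.\<close>
  define r where "r = e / 2"
  have r: "r > 0" using e by (simp add: r_def)
  have sep: "a = b" if "a \<in> E" "b \<in> E" "dist c a < r" "dist c b < r" for a b c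
    using e(2)[OF that(1,2)] dist_triangle_half_r[of c a e b] that by (simp add: r_def dist_commute)
  \<comment> \<open>The strict bound is the hypothesis of \<open>eigenvalue_near\<close> at the
    centre \<open>\<mu>\<close>. It holds at \<open>x\<close>, where the determinant vanishes, and
    defines a relatively open set because \<open>E\<close> is finite.\<close>
  define T where "T = {y \<in> S. \<forall>\<mu>\<in>E. norm (det (mat \<mu> - A y)) < r ^ CARD('n)}"
  have TS: "T \<subseteq> S" by (auto simp: T_def)
  have xT: "x \<in> T"
    using x r by (auto simp: T_def E_def eigenvalue_iff_det)
  have openin_near: "openin (top_of_set S) (S \<inter> (\<lambda>y. norm (det (mat \<mu> - A y))) -` {..<r ^ CARD('n)})" for \<mu>
    by (intro continuous_openin_preimage_gen continuous_on_norm continuous_on_det_char contA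
        open_lessThan)
  have "T = S \<inter> (\<Inter>\<mu>\<in>E. S \<inter> (\<lambda>y. norm (det (mat \<mu> - A y))) -` {..<r ^ CARD('n)})"
    by (auto simp: T_def)
  also have "openin (top_of_set S) \<dots>"
    by (intro openin_Int_Inter) (use finE openin_near in auto)
  finally have openT: "openin (top_of_set S) T" .
  have ex: "\<exists>\<nu>. \<nu> \<in> eigenvalues (A y) \<and> dist \<nu> \<mu> < r" if "y \<in> T" "\<mu> \<in> E" for y \<mu>
    using that r eigenvalue_near[of "A y" r \<mu>] dist by (auto simp: T_def)
  define h where "h y \<mu> = (SOME \<nu>. \<nu> \<in> eigenvalues (A y) \<and> dist \<nu> \<mu> < r)" for y \<mu>
  have h: "h y \<mu> \<in> eigenvalues (A y)" "dist (h y \<mu>) \<mu> < r" if "y \<in> T" "\<mu> \<in> E" for y \<mu>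
    using someI_ex[OF ex[OF that]] by (auto simp: h_def)
  txt \<open>The \<open>n\<close> disjoint discs each contain at least one of the \<open>n\<close> eigenvalues of \<open>A y\<close>, so exactly
    one.\<close>
  have surj: "h y ` E = eigenvalues (A y)" if y: "y \<in> T" for y
  proof (rule card_seteq)
    have yS: "y \<in> S" using y TS by auto
    show "finite (eigenvalues (A y))" using finite_eigenvalues dist yS by blast
    show "h y ` E \<subseteq> eigenvalues (A y)" using h y by auto
    have "inj_on (h y) E"
      by (rule inj_onI) (metis sep h(2) y)
    then have "card (h y ` E) = card E" by (rule card_image)
    then show "card (eigenvalues (A y)) \<le> card (h y ` E)"
      using dist x yS by (simp add: E_def distinct_eigenvalues_def)
  qed
  have uniq: "\<nu> = h y \<mu>" if y: "y \<in> T" and \<mu>: "\<mu> \<in> E" and \<nu>: "\<nu> \<in> eigenvalues (A y)" "dist \<nu> \<mu> < r" for y \<mu> \<nu>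
  proof -
    obtain a where a: "a \<in> E" "\<nu> = h y a" using surj[OF y] \<nu>(1) by blast
    have "a = \<mu>" using sep[OF a(1) \<mu> _ \<nu>(2)] h(2)[OF y a(1)] a(2) by simp
    then show ?thesis using a(2) by simp
  qed
  have conth: "continuous_on T (\<lambda>y. h y \<mu>)" if \<mu>: "\<mu> \<in> E" for \<mu>
    unfolding continuous_on_def
  proof (intro ballI tendstoI)
    fix y and \<epsilon> :: real
    assume y: "y \<in> T" and "\<epsilon> > 0"
    \<comment> \<open>An eigenvalue of \<open>A y'\<close> within \<open>\<delta>\<close> of
      \<open>h y \<mu>\<close> is \<open>\<epsilon>\<close>-close to it and still lies in the disc
      around \<open>\<mu>\<close>; uniqueness there identifies it with
      \<open>h y' \<mu>\<close>.\<close>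
    define \<delta> where "\<delta> = min \<epsilon> (r - dist (h y \<mu>) \<mu>)"
    have \<delta>: "\<delta> > 0" using h[OF y \<mu>] \<open>\<epsilon> > 0\<close> by (simp add: \<delta>_def)
    have "continuous_on T (\<lambda>y'. norm (det (mat (h y \<mu>) - A y')))"
      by (intro continuous_on_norm continuous_on_det_char continuous_on_subset[OF contA TS])
    then have "((\<lambda>y'. norm (det (mat (h y \<mu>) - A y'))) \<longlongrightarrow> norm (det (mat (h y \<mu>) - A y))) (at y within T)"
      using y by (simp add: continuous_on_def)
    moreover have "norm (det (mat (h y \<mu>) - A y)) < \<delta> ^ CARD('n)"
      using h[OF y \<mu>] \<delta> by (simp add: eigenvalue_iff_det)
    ultimately have "\<forall>\<^sub>F y' in at y within T. norm (det (mat (h y \<mu>) - A y')) < \<delta> ^ CARD('n)"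
      by (rule order_tendstoD)
    moreover have "\<forall>\<^sub>F y' in at y within T. y' \<in> T"
      by (auto simp: eventually_at_filter)
    ultimately show "\<forall>\<^sub>F y' in at y within T. dist (h y' \<mu>) (h y \<mu>) < \<epsilon>"
    proof eventually_elim
      case (elim y')
      then obtain \<nu> where \<nu>: "\<nu> \<in> eigenvalues (A y')" "dist \<nu> (h y \<mu>) < \<delta>"
        using eigenvalue_near[of "A y'" \<delta> "h y \<mu>"] dist TS \<delta> by auto
      then have "dist \<nu> \<mu> < r"
        using dist_triangle[of \<nu> \<mu> "h y \<mu>"] by (simp add: \<delta>_def)
      then show ?case using uniq[OF elim(2) \<mu> \<nu>(1)] \<nu>(2) by (simp add: \<delta>_def)
    qed
  qed
  \<comment> \<open>The sheet through \<open>(x, \<mu>)\<close>: by uniqueness in the disc it is the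
    graph of \<open>\<lambda>y. h y \<mu>\<close> over \<open>T\<close>.\<close>
  define U where "U \<mu> = ?C \<inter> (T \<times> ball \<mu> r)" for \<mu>
  show "\<exists>T. x \<in> T \<and> openin (top_of_set S) T \<and>
          (\<exists>v. \<Union>v = ?C \<inter> fst -` T \<and> (\<forall>u\<in>v. openin (top_of_set ?C) u) \<and>
               pairwise disjnt v \<and> (\<forall>u\<in>v. \<exists>q. homeomorphism u T fst q))"
  proof (intro exI conjI)
    show "x \<in> T" by (rule xT)
    show "openin (top_of_set S) T" by (rule openT)
    show "\<Union> (U ` E) = ?C \<inter> fst -` T"
    proof
      show "?C \<inter> fst -` T \<subseteq> \<Union> (U ` E)"
      proof
        fix p assume p: "p \<in> ?C \<inter> fst -` T"
        then have "snd p \<in> h (fst p) ` E"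
          using surj[of "fst p"] by auto
        then obtain \<mu> where "\<mu> \<in> E" "snd p = h (fst p) \<mu>"
          by blast
        then show "p \<in> \<Union> (U ` E)"
          using p h(2)[of "fst p" \<mu>] by (auto simp: U_def dist_commute intro!: bexI[of _ \<mu>])
      qed
    qed (auto simp: U_def)
    show "\<forall>u\<in>U ` E. openin (top_of_set ?C) u"
    proof safe
      fix \<mu> assume "\<mu> \<in> E"
      obtain W where W: "open W" "T = S \<inter> W" using openT by (auto simp: openin_open)
      have "U \<mu> = ?C \<inter> (W \<times> ball \<mu> r)" by (auto simp: U_def W(2))
      then show "openin (top_of_set ?C) (U \<mu>)"
        using W(1) by (auto intro!: openin_open_Int open_Times)
    qed
    show "pairwise disjnt (U ` E)"
      by (auto simp: pairwise_def disjnt_def U_def dest: sep simp: dist_commute)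
    show "\<forall>u\<in>U ` E. \<exists>q. homeomorphism u T fst q"
    proof safe
      fix \<mu> assume \<mu>: "\<mu> \<in> E"
      have "homeomorphism (U \<mu>) T fst (\<lambda>y. (y, h y \<mu>))"
      proof (rule homeomorphismI)
        show "continuous_on (U \<mu>) fst" by (intro continuous_intros)
        show "continuous_on T (\<lambda>y. (y, h y \<mu>))" by (intro continuous_intros conth \<mu>)
        show "fst ` U \<mu> \<subseteq> T" by (auto simp: U_def)
        show "(\<lambda>y. (y, h y \<mu>)) ` T \<subseteq> U \<mu>"
          using h[OF _ \<mu>] TS by (auto simp: U_def dist_commute)
        show "(fst p, h (fst p) \<mu>) = p" if "p \<in> U \<mu>" for p
          using that uniq[OF _ \<mu>, of "fst p" "snd p"] by (auto simp: U_def dist_commute)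
      qed auto
      then show "\<exists>q. homeomorphism (U \<mu>) T fst q" by blast
    qed
  qed
qed

text \<open>A convex set is simply connected, so its identity map lifts to a section
  \<open>g\<close> of the spectrum through \<open>(\<gamma> s, \<mu> s)\<close>. Both
  \<open>g\<close> along \<open>\<gamma>\<close> and the pair of \<open>\<gamma>\<close> and
  \<open>\<mu>\<close> lift \<open>\<gamma>\<close> and agree at \<open>s\<close>, hence on the
  connected set \<open>T\<close>. So \<open>\<mu>\<close> depends only on the point of the
  curve.\<close>

lemma eigenvalue_branch_factors:
  fixes A :: "'a::real_normed_vector \<Rightarrow> complex^'n^'n"
  assumes S: "convex S" and contA: "continuous_on S A"
    and dist: "\<And>x. x \<in> S \<Longrightarrow> distinct_eigenvalues (A x)"
    and T: "connected T" and cont\<gamma>: "continuous_on T \<gamma>" and \<gamma>S: "\<gamma> \<in> T \<rightarrow> S"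
    and cont\<mu>: "continuous_on T \<mu>" and \<mu>: "\<And>t. t \<in> T \<Longrightarrow> \<mu> t \<in> eigenvalues (A (\<gamma> t))"
    and st: "s \<in> T" "t \<in> T" and eq: "\<gamma> s = \<gamma> t"
  shows "\<mu> s = \<mu> t"
proof -
  let ?C = "SIGMA x:S. eigenvalues (A x)"
  have cov: "covering_space ?C fst S"
    by (rule covering_space_eigenvalues[OF contA dist])
  have sS: "\<gamma> s \<in> S" using \<gamma>S st by auto
  obtain g where g: "continuous_on S g" "g \<in> S \<rightarrow> ?C" "g (\<gamma> s) = (\<gamma> s, \<mu> s)"
      and fst: "\<And>x. x \<in> S \<Longrightarrow> fst (g x) = x"
  proof (rule covering_space_lift_strong[OF cov, of "(\<gamma> s, \<mu> s)" "\<gamma> s" S "\<lambda>x. x"])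
    show "(\<gamma> s, \<mu> s) \<in> ?C" using sS \<mu> st by auto
  qed (use S sS in \<open>auto simp: convex_imp_simply_connected convex_imp_locally_path_connected\<close>)
  have "g (\<gamma> t) = (\<gamma> t, \<mu> t)"
  proof (rule covering_space_lift_unique[OF cov, of "\<lambda>t. g (\<gamma> t)" s "\<lambda>t. (\<gamma> t, \<mu> t)" T \<gamma>])
    show "continuous_on T (\<lambda>t. g (\<gamma> t))"
      using \<gamma>S by (intro continuous_on_compose2[OF g(1) cont\<gamma>]) auto
    show "continuous_on T (\<lambda>t. (\<gamma> t, \<mu> t))"
      by (intro continuous_intros cont\<gamma> cont\<mu>)
    show "(\<lambda>t. g (\<gamma> t)) \<in> T \<rightarrow> ?C" using g(2) \<gamma>S by auto
    show "\<gamma> x = fst (g (\<gamma> x))" if "x \<in> T" for x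
      using fst[of "\<gamma> x"] \<gamma>S that by (simp add: Pi_iff)
  qed (use g \<gamma>S \<mu> st T cont\<gamma> in auto)
  then show ?thesis using g(3) eq by simp
qed

section \<open>Derivatives of columns, determinants and Hermitian products\<close>

lemma matrix_inv:
  fixes A :: "'a::semiring_1^'n^'m"
  assumes "invertible A"
  shows "A ** matrix_inv A = mat 1" "matrix_inv A ** A = mat 1"
  using someI_ex[OF assms[unfolded invertible_def]] by (simp_all add: matrix_inv_def)

lemma has_vector_derivative_column:
  fixes M :: "real \<Rightarrow> complex^'n^'n"
  assumes "(M has_vector_derivative D) F"
  shows "((\<lambda>s. column j (M s)) has_vector_derivative column j D) F"
proof -
  have "linear (column j :: complex^'n^'n \<Rightarrow> _)"
    by (rule linearI) (simp_all add: column_def vec_eq_iff)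
  then show ?thesis
    unfolding linear_conv_bounded_linear by (rule bounded_linear.has_vector_derivative[OF _ assms])
qed

lemma matrix_scaleR_right: "A ** (c *\<^sub>R B) = c *\<^sub>R (A ** B)"
  for A :: "'a::real_algebra_1^'n^'m"
  by (simp add: matrix_matrix_mult_def vec_eq_iff scaleR_sum_right)

lemma has_vector_derivative_matrix_mult_left:
  fixes M :: "real \<Rightarrow> complex^'n^'n"
  assumes "(M has_vector_derivative D) F"
  shows "((\<lambda>s. W ** M s) has_vector_derivative W ** D) F"
proof -
  have "linear (\<lambda>M. W ** M)"
    by (rule linearI)
      (simp_all add: matrix_add_ldistrib matrix_scaleR_right)
  then show ?thesis
    unfolding linear_conv_bounded_linear by (rule bounded_linear.has_vector_derivative[OF _ assms])
qed

lemma has_vector_derivative_entry: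
  fixes M :: "real \<Rightarrow> complex^'n^'n"
  assumes "(M has_vector_derivative D) F"
  shows "((\<lambda>s. M s $ i $ j) has_vector_derivative D $ i $ j) F"
  by (intro bounded_linear.has_vector_derivative[OF bounded_linear_vec_nth] assms)

lemma has_vector_derivative_prod:
  fixes f :: "'i \<Rightarrow> real \<Rightarrow> complex"
  assumes "\<And>i. i \<in> I \<Longrightarrow> (f i has_vector_derivative D i) (at t)"
  shows "((\<lambda>s. \<Prod>i\<in>I. f i s) has_vector_derivative (\<Sum>i\<in>I. D i * (\<Prod>j\<in>I - {i}. f j t))) (at t)"
  unfolding has_vector_derivative_def
  by (rule has_derivative_eq_rhs[OF has_derivative_prod])
    (use assms in \<open>auto simp: has_vector_derivative_def fun_eq_iff scaleR_sum_right\<close>)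

text \<open>In the Leibniz expansion a permutation other than \<open>id\<close> moves two distinct
  points, \<open>a\<close> and \<open>p a\<close>. The product rule differentiates only one factor,
  so an off-diagonal entry of the identity remains and the term vanishes. The identity permutation
  contributes the trace.\<close>

lemma has_vector_derivative_det_at_mat_1:
  fixes M :: "real \<Rightarrow> complex^'n^'n"
  assumes M: "(M has_vector_derivative D) (at t)" and 1: "M t = mat 1"
  shows "((\<lambda>s. det (M s)) has_vector_derivative trace D) (at t)"
proof -
  let ?D = "\<lambda>p. \<Sum>i\<in>UNIV. D $ i $ p i * (\<Prod>k\<in>UNIV - {i}. M t $ k $ p k)"
  have "((\<lambda>s. det (M s)) has_vector_derivative
      (\<Sum>p | p permutes (UNIV :: 'n set). of_int (sign p) * ?D p)) (at t)"
    unfolding det_def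
    by (intro has_vector_derivative_sum has_vector_derivative_mult_right has_vector_derivative_prod
        has_vector_derivative_entry M)
  also have "(\<Sum>p | p permutes (UNIV :: 'n set). of_int (sign p) * ?D p) =
      (\<Sum>p\<in>{id}. of_int (sign p) * ?D p)"
  proof (rule sum.mono_neutral_right; (intro ballI)?)
    fix p :: "'n \<Rightarrow> 'n"
    assume "p \<in> {p. p permutes UNIV} - {id}"
    then have p: "p permutes UNIV" and "p \<noteq> id" by auto
    obtain a where a: "p a \<noteq> a" using \<open>p \<noteq> id\<close> by (auto simp: fun_eq_iff)
    then have pa: "p (p a) \<noteq> p a" using permutes_inj[OF p] by (auto dest: injD)
    have zero: "D $ i $ p i * (\<Prod>k\<in>UNIV - {i}. M t $ k $ p k) = 0" for i
    proof -
      from a pa obtain k where "k \<noteq> i" "p k \<noteq> k" by metis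
      then show ?thesis
        by (auto simp: 1 mat_def intro!: prod_zero bexI[of _ k])
    qed
    show "of_int (sign p) * ?D p = 0"
      by (simp only: zero sum.neutral_const mult_zero_right)
  qed (auto simp: permutes_id)
  also have "\<dots> = of_int (sign id) * ?D id" by simp
  also have "of_int (sign id) * ?D id = trace D"
    by (simp add: 1 mat_def trace_def)
  finally show ?thesis .
qed

text \<open>Jacobi's formula, reduced to the identity matrix by factoring \<open>det (M t)\<close>
  out of \<open>det (M s)\<close>.\<close>

lemma has_vector_derivative_det:
  fixes M :: "real \<Rightarrow> complex^'n^'n"
  assumes M: "(M has_vector_derivative D) (at t)" and inv: "invertible (M t)"
  shows "((\<lambda>s. det (M s)) has_vector_derivative det (M t) * trace (matrix_inv (M t) ** D)) (at t)"
proof -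
  have "((\<lambda>s. det (M t) * det (matrix_inv (M t) ** M s)) has_vector_derivative
      det (M t) * trace (matrix_inv (M t) ** D)) (at t)"
    by (intro has_vector_derivative_mult_right has_vector_derivative_det_at_mat_1
        has_vector_derivative_matrix_mult_left M matrix_inv inv)
  then show ?thesis
    by (simp add: det_mul[symmetric] matrix_mul_assoc matrix_inv[OF inv])
qed

lemma has_vector_derivative_hprod:
  assumes "(x has_vector_derivative x') (at t)" "(y has_vector_derivative y') (at t)"
  shows "((\<lambda>s. hprod (x s) (y s)) has_vector_derivative hprod x' (y t) + hprod (x t) y') (at t)"
proof -
  have "((\<lambda>s. cnj (x s $ i) * y s $ i) has_vector_derivative
      cnj (x t $ i) * y' $ i + cnj (x' $ i) * y t $ i) (at t)" for i
    by (intro has_vector_derivative_mult has_vector_derivative_cnj assms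
        bounded_linear.has_vector_derivative[OF bounded_linear_vec_nth])
  then show ?thesis
    unfolding hprod_def sum.distrib[symmetric]
    by (intro has_vector_derivative_sum) (simp add: add.commute)
qed

lemma hprod_commute: "hprod y x = cnj (hprod x y)"
  by (simp add: hprod_def mult.commute)

lemma hprod_scale_left: "hprod (c *s x) y = cnj c * hprod x y"
  by (simp add: hprod_def sum_distrib_left mult.assoc)

lemma hprod_scale_right: "hprod x (c *s y) = c * hprod x y"
  by (simp add: hprod_def sum_distrib_left mult.left_commute)

lemma hprod_sum_right: "hprod x (\<Sum>l\<in>I. f l) = (\<Sum>l\<in>I. hprod x (f l))"
  by (simp add: hprod_def sum_distrib_left sum.swap[of _ I])

lemma hprod_self: "hprod x x = of_real ((norm x)\<^sup>2)"
  by (simp add: hprod_def norm_vec_def L2_set_def sum_nonneg complex_norm_square mult.commute del: of_real_power)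

section \<open>Parallel-transport eigendecompositions: conserved quantities and behaviour under a
  shift\<close>

lemma Ck_on_differentiable:
  assumes "Ck_on k f S" "k \<ge> 1" "x \<in> S"
  shows "f differentiable (at x)"
  using assms by (cases k) auto

lemma Ck_on_continuous_on:
  assumes "Ck_on k f S" "k \<ge> 1"
  shows "continuous_on S f"
  by (intro continuous_at_imp_continuous_on ballI differentiable_imp_continuous_within
      Ck_on_differentiable[OF assms])

context
  fixes k :: nat and B V :: "real \<Rightarrow> complex^'n^'n" and lam :: "real \<Rightarrow> complex^'n"
  assumes k: "k \<ge> 1" and PT: "parallel_transport_eigendecomposition k B V lam"
begin

lemma invertible_V: "invertible (V t)"
  using PT by (auto simp: parallel_transport_eigendecomposition_def Ck_eigendecomposition_def)

lemma B_V: "B t ** V t = V t ** diag (lam t)"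
proof -
  have "B t = V t ** diag (lam t) ** matrix_inv (V t)"
    using PT by (auto simp: parallel_transport_eigendecomposition_def Ck_eigendecomposition_def)
  then show ?thesis
    by (simp add: matrix_mul_assoc[symmetric] matrix_inv[OF invertible_V])
qed

lemma continuous_lam: "continuous_on UNIV (\<lambda>t. lam t $ j)"
proof -
  have "Ck_on k (\<lambda>t. diag (lam t)) UNIV"
    using PT unfolding parallel_transport_eigendecomposition_def Ck_eigendecomposition_def by blast
  then have "continuous_on UNIV (\<lambda>t. diag (lam t))"
    using Ck_on_continuous_on k by blast
  then have "continuous_on UNIV (\<lambda>t. diag (lam t) $ j $ j)"
    by (intro continuous_intros)
  then show ?thesis by (simp add: diag_def)
qed

lemma V_has_vector_derivative:
  "(V has_vector_derivative V t ** transport_matrix V t) (at t)"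
proof -
  have "Ck_on k V UNIV"
    using PT unfolding parallel_transport_eigendecomposition_def Ck_eigendecomposition_def by blast
  then have "V differentiable at t"
    using Ck_on_differentiable[OF _ k UNIV_I] by blast
  then show ?thesis
    by (simp add: transport_matrix_def matrix_mul_assoc matrix_inv[OF invertible_V]
        flip: vector_derivative_works)
qed

lemma Im_transport_matrix: "Im (transport_matrix V t $ j $ j) = 0"
  using PT by (simp add: parallel_transport_eigendecomposition_def Let_def)

text \<open>The real-part condition of parallel transport with all terms on one side:
  \<open>V t *v column j P\<close> is the derivative of the column \<open>v_j\<close>, expanded in
  the eigenbasis.\<close>

lemma Re_hprod_derivative:
  "Re (hprod (column j (V t)) (V t *v column j (transport_matrix V t))) = 0"
proof -
  let ?P = "transport_matrix V t" and ?v = "\<lambda>l. column l (V t)"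
  have "hprod (?v j) (V t *v column j ?P) = (\<Sum>l\<in>UNIV. hprod (?v j) (?v l) * ?P $ l $ j)"
    by (simp add: matrix_mult_sum hprod_sum_right hprod_scale_right column_def[of j ?P] mult.commute)
  then have "Re (hprod (?v j) (V t *v column j ?P)) =
      Re (hprod (?v j) (?v j) * ?P $ j $ j) + (\<Sum>l\<in>UNIV - {j}. Re (hprod (?v j) (?v l) * ?P $ l $ j))"
    by (simp add: sum.remove[of UNIV j] Re_sum del: times_complex.sel)
  moreover have "Re (hprod (?v j) (?v j) * ?P $ j $ j) =
      - (\<Sum>l\<in>UNIV - {j}. Re (hprod (?v j) (?v l) * ?P $ l $ j))"
    using PT unfolding parallel_transport_eigendecomposition_def Let_def by blast
  ultimately show ?thesis by linarith
qed

text \<open>The derivative of the squared norm is \<open>v_j^* v_j'\<close> plus its conjugate, that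
  is, twice the real part just shown to vanish.\<close>

lemma hprod_column_constant:
  "hprod (column j (V t)) (column j (V t)) = hprod (column j (V s)) (column j (V s))"
proof -
  let ?N = "\<lambda>t. hprod (column j (V t)) (column j (V t))"
  have "(?N has_vector_derivative 0) (at t)" for t
  proof -
    let ?v' = "column j (V t ** transport_matrix V t)"
    have "(?N has_vector_derivative hprod ?v' (column j (V t)) + hprod (column j (V t)) ?v') (at t)"
      by (intro has_vector_derivative_hprod has_vector_derivative_column V_has_vector_derivative)
    also have "hprod ?v' (column j (V t)) + hprod (column j (V t)) ?v' = 0"
      using Re_hprod_derivative[of j t]
      by (subst hprod_commute) (simp add: column_matrix_mult complex_eq_iff)
    finally show ?thesis .
  qed
  then obtain c where "\<And>t. ?N t = c"
    using has_vector_derivative_zero_constant[of UNIV ?N] by auto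
  then show ?thesis by simp
qed

text \<open>As the trace of the transport matrix is real, the determinant and its conjugate have the
  same logarithmic derivative. Their quotient is the square of the phase of the determinant.\<close>

lemma det_phase_constant: "det (V t) / cnj (det (V t)) = det (V s) / cnj (det (V s))"
proof -
  let ?W = "\<lambda>t. det (V t)"
  have "((\<lambda>t. ?W t / cnj (?W t)) has_vector_derivative 0) (at t)" for t
  proof -
    let ?\<rho> = "trace (transport_matrix V t)"
    have W: "(?W has_vector_derivative ?W t * ?\<rho>) (at t)"
      using has_vector_derivative_det[OF V_has_vector_derivative invertible_V, of t]
      by (simp add: matrix_mul_assoc matrix_inv[OF invertible_V])
    have \<rho>: "cnj ?\<rho> = ?\<rho>"
      by (simp add: trace_def Im_transport_matrix complex_eq_iff)
    have "?W t \<noteq> 0" using invertible_V by (simp add: invertible_det_nz)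
    then show ?thesis
      using has_derivative_divide'[OF W[unfolded has_vector_derivative_def]
          has_vector_derivative_cnj[OF W, unfolded has_vector_derivative_def]]
      by (simp add: has_vector_derivative_def \<rho> mult_ac)
  qed
  then obtain c where "\<And>t. ?W t / cnj (?W t) = c"
    using has_vector_derivative_zero_constant[of UNIV "\<lambda>t. ?W t / cnj (?W t)"] by auto
  then show ?thesis by simp
qed

lemma inj_V: "V t *v x = V t *v y \<Longrightarrow> x = y"
  by (metis matrix_vector_mul_assoc matrix_vector_mul_lid matrix_inv(2)[OF invertible_V])

lemma column_V_nonzero: "column j (V t) \<noteq> 0"
proof
  assume "column j (V t) = 0"
  then have "V t *v axis j 1 = V t *v 0" by (simp add: matrix_mult_axis)
  then have "axis j 1 = (0 :: complex^'n)" by (rule inj_V)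
  then have "axis j 1 $ j = (0 :: complex)" by simp
  then show False by (simp add: axis_def)
qed

lemma inj_lam:
  assumes "distinct_eigenvalues (B t)"
  shows "inj (($) (lam t))"
  using assms eigenvalues_diagonalized[OF B_V invertible_V, of t]
  by (intro eq_card_imp_inj_on) (simp_all add: distinct_eigenvalues_def)

text \<open>In eigenbasis coordinates \<open>w\<close> the eigenvalue equation becomes
  \<open>lam t $ i * w $ i = lam t $ j * w $ i\<close>, and distinctness kills every coordinate
  except the one at \<open>j\<close>.\<close>

lemma eigenvector_multiple:
  assumes dist: "distinct_eigenvalues (B t)" and x: "B t *v x = lam t $ j *s x"
  obtains c where "x = c *s column j (V t)"
proof -
  define w where "w = matrix_inv (V t) *v x"
  have xw: "x = V t *v w"
    by (simp add: w_def matrix_vector_mul_assoc matrix_inv[OF invertible_V])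
  have "V t *v (diag (lam t) *v w) = B t *v x"
    by (simp add: xw matrix_vector_mul_assoc B_V)
  also have "\<dots> = lam t $ j *s x" by (rule x)
  also have "\<dots> = V t *v (lam t $ j *s w)"
    by (simp add: xw vector_scalar_commute)
  finally have "diag (lam t) *v w = lam t $ j *s w" by (rule inj_V)
  then have "lam t $ i * w $ i = lam t $ j * w $ i" for i
    by (simp add: diag_mult_vector vec_eq_iff)
  then have "w $ i = 0" if "i \<noteq> j" for i
    using that injD[OF inj_lam[OF dist], of i j] by auto
  then have "x = w $ j *s column j (V t)"
    unfolding xw by (subst matrix_mult_sum, subst sum.remove[of _ j]) (auto intro!: sum.neutral)
  then show ?thesis by (rule that)
qed

text \<open>A shifted column is an eigenvector for the same simple eigenvalue, which gives a scalar
  \<open>c j t\<close> at each time. Constant norms make it unimodular; real diagonal entries of the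
  transport matrix exclude any rotation, so it does not depend on \<open>t\<close>.\<close>

lemma column_shift:
  assumes dist: "\<And>t. distinct_eigenvalues (B t)"
    and B: "\<And>t. B (t + p) = B t" and lam: "\<And>t. lam (t + p) = lam t"
  obtains c where "\<And>j. norm (c j) = 1" "\<And>j t. column j (V (t + p)) = c j *s column j (V t)"
proof -
  let ?v = "\<lambda>j t. column j (V t)" and ?P = "transport_matrix V"
  have "\<exists>c. ?v j (t + p) = c *s ?v j t" for j t
  proof -
    have "B t *v ?v j (t + p) = column j (B (t + p) ** V (t + p))"
      by (simp add: B column_matrix_mult)
    also have "\<dots> = lam t $ j *s ?v j (t + p)"
      by (simp add: B_V matrix_mult_diag lam)
    finally show ?thesis using eigenvector_multiple[OF dist] by blast
  qed
  then obtain c where c: "\<And>j t. ?v j (t + p) = c j t *s ?v j t" by metis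
  define N where "N j = hprod (?v j 0) (?v j 0)" for j
  have N: "hprod (?v j t) (?v j t) = N j" for j t
    unfolding N_def by (rule hprod_column_constant)
  have N0: "N j \<noteq> 0" for j
    using column_V_nonzero by (simp add: N_def hprod_self)
  \<comment> \<open>The scalars were chosen pointwise; this formula is what makes \<open>c j\<close>
    differentiable.\<close>
  have c_eq: "c j t = hprod (?v j t) (?v j (t + p)) / N j" for j t
    using N0 by (simp add: c hprod_scale_right N)
  have c1: "cnj (c j t) * c j t = 1" for j t
    using N[of j "t + p"] N0[of j] by (simp add: c hprod_scale_left hprod_scale_right N mult.commute)
  have V_shift: "((\<lambda>s. V (s + p)) has_vector_derivative V (t + p) ** ?P (t + p)) (at t)" for t
  proof -
    have "((\<lambda>s. s + p) has_vector_derivative 1) (at t)"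
      by (auto intro!: derivative_eq_intros)
    from vector_diff_chain_at[OF this V_has_vector_derivative] show ?thesis
      by (simp add: o_def)
  qed
  have "(c j has_vector_derivative 0) (at t)" for j t
  proof -
    obtain c' where c': "(c j has_vector_derivative c') (at t)"
    proof
      show "(c j has_vector_derivative
          (hprod (column j (V t ** ?P t)) (?v j (t + p)) +
           hprod (?v j t) (column j (V (t + p) ** ?P (t + p)))) / N j) (at t)"
        unfolding c_eq[abs_def]
        by (intro has_vector_derivative_divide has_vector_derivative_hprod
            has_vector_derivative_column V_has_vector_derivative V_shift)
    qed
    have entry: "V (s + p) $ i $ j = c j s * V s $ i $ j" for i s
      using c[where j = j and t = s] by (simp add: vec_eq_iff column_def)
    \<comment> \<open>The derivative of the shifted entry is computed twice, by the chain rule and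
      by the product rule for \<open>c j s * V s $ i $ j\<close>.\<close>
    have "(V (t + p) ** ?P (t + p)) $ i $ j = c j t * (V t ** ?P t) $ i $ j + c' * V t $ i $ j" for i
    proof (rule vector_derivative_unique_at)
      show "((\<lambda>s. V (s + p) $ i $ j) has_vector_derivative (V (t + p) ** ?P (t + p)) $ i $ j) (at t)"
        by (rule has_vector_derivative_entry[OF V_shift])
      show "((\<lambda>s. V (s + p) $ i $ j) has_vector_derivative
          c j t * (V t ** ?P t) $ i $ j + c' * V t $ i $ j) (at t)"
        unfolding entry
        by (intro has_vector_derivative_mult c' has_vector_derivative_entry V_has_vector_derivative)
    qed
    then have "V (t + p) *v column j (?P (t + p)) = c j t *s (V t *v column j (?P t)) + c' *s ?v j t"
      unfolding column_matrix_mult[symmetric] by (simp add: vec_eq_iff column_def)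
    also have "\<dots> = V t *v (c j t *s column j (?P t) + c' *s axis j 1)"
      by (simp add: matrix_vector_right_distrib vector_scalar_commute matrix_mult_axis)
    \<comment> \<open>The columns of \<open>V (t + p)\<close> are replaced by multiples of those of
      \<open>V t\<close>, so that both sides are images under \<open>V t\<close> and can be compared
      coordinatewise.\<close>
    also have "V (t + p) *v column j (?P (t + p)) = V t *v (\<chi> l. c l t * ?P (t + p) $ l $ j)"
      by (simp add: matrix_mult_sum c column_def[of j "?P _"] mult.commute)
    finally have "(\<chi> l. c l t * ?P (t + p) $ l $ j) = c j t *s column j (?P t) + c' *s axis j 1"
      by (rule inj_V)
    then have "c j t * ?P (t + p) $ j $ j = c j t * ?P t $ j $ j + c'"
      by (simp add: vec_eq_iff column_def axis_def)
    then have c'_eq: "c' = c j t * (?P (t + p) $ j $ j - ?P t $ j $ j)"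
      by (simp add: algebra_simps)
    define r where "r = ?P (t + p) $ j $ j - ?P t $ j $ j"
    have r: "cnj r = r"
      by (simp add: r_def complex_eq_iff Im_transport_matrix)
    \<comment> \<open>Since \<open>c' = c j t * r\<close> with \<open>r\<close> real, the squared
      modulus has derivative \<open>2 * r\<close>; being constantly 1, it forces
      \<open>r = 0\<close>.\<close>
    have "((\<lambda>s. cnj (c j s) * c j s) has_vector_derivative cnj (c j t) * c' + cnj c' * c j t) (at t)"
      by (intro has_vector_derivative_mult has_vector_derivative_cnj c')
    moreover have "((\<lambda>s. cnj (c j s) * c j s) has_vector_derivative 0) (at t)"
      by (simp add: c1)
    ultimately have "cnj (c j t) * c' + cnj c' * c j t = 0"
      by (rule vector_derivative_unique_at)
    moreover have "cnj (c j t) * c' + cnj c' * c j t = 2 * r * (cnj (c j t) * c j t)"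
      by (simp add: c'_eq r r_def[symmetric])
    ultimately have "r = 0" by (simp add: c1)
    then show ?thesis using c' by (simp add: c'_eq r_def)
  qed
  then have const: "c j t = c j 0" for j t
    using has_vector_derivative_zero_constant[of UNIV "c j"] by (metis UNIV_I convex_UNIV)
  show ?thesis
  proof (rule that[of "\<lambda>j. c j 0"])
    show "norm (c j 0) = 1" for j
    proof -
      have "(norm (c j 0))\<^sup>2 = 1\<^sup>2"
        using arg_cong[OF c1[of j 0], of norm] by (simp add: norm_mult power2_eq_square)
      then show ?thesis by (rule power2_eq_imp_eq) simp_all
    qed
    show "?v j (t + p) = c j 0 *s ?v j t" for j t
      using c[of j t] by (simp add: const[of j t])
  qed
qed

end

section \<open>Eigenvalues and phases after one turn around the curve\<close>

theorem theorem2p15: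
  fixes k :: nat
    and \<Omega> \<Gamma> :: "(real^2) set"
    and A :: "real^2 \<Rightarrow> complex^'n^'n"
    and \<gamma> :: "real \<Rightarrow> real^2"
    and V :: "real \<Rightarrow> complex^'n^'n"
    and lam :: "real \<Rightarrow> complex^'n"
  assumes "k \<ge> 1"
    and "open \<Omega>" and "convex \<Omega>"
    and "Ck_on k A \<Omega>"
    and "\<And>x. x \<in> \<Omega> \<Longrightarrow> distinct_eigenvalues (A x)"
    and "smooth_Jordan_curve \<gamma>" and "\<Gamma> = range \<gamma>" and "\<Gamma> \<subseteq> \<Omega>"
    and "minimal_period 1 (\<lambda>t. A (\<gamma> t))"
    and "parallel_transport_eigendecomposition k (\<lambda>t. A (\<gamma> t)) V lam"
  shows "\<exists>\<alpha> :: 'n \<Rightarrow> real.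
           (\<forall>j t. lam (t + 1) $ j = lam t $ j) \<and>
           (\<forall>j t. column j (V (t + 1)) = exp (\<i> * complex_of_real (\<alpha> j)) *s column j (V t)) \<and>
           [(\<Sum>j\<in>UNIV. \<alpha> j) = 0] (rmod pi)"
proof -
  let ?B = "\<lambda>t. A (\<gamma> t)"
  note k = assms(1) and PT = assms(10)
  have \<gamma>\<Omega>: "\<gamma> t \<in> \<Omega>" for t using assms(7,8) by auto
  have dist: "distinct_eigenvalues (?B t)" for t using assms(5) \<gamma>\<Omega> by blast
  have \<gamma>: "continuous_on UNIV \<gamma>" "\<And>t. \<gamma> (t + 1) = \<gamma> t"
    using assms(6) C1_differentiable_imp_continuous_on
    by (auto simp: smooth_Jordan_curve_def minimal_period_def)
  have lam_j: "lam (t + 1) $ j = lam t $ j" for t j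
  proof (rule eigenvalue_branch_factors[of \<Omega> A UNIV \<gamma> "\<lambda>t. lam t $ j"])
    show "continuous_on \<Omega> A" by (rule Ck_on_continuous_on[OF assms(4) k])
    show "continuous_on UNIV (\<lambda>t. lam t $ j)" by (rule continuous_lam[OF k PT])
    show "lam t $ j \<in> eigenvalues (A (\<gamma> t))" for t
      using eigenvalues_diagonalized[OF B_V[OF k PT] invertible_V[OF k PT]] by auto
  qed (use assms(3,5) \<gamma> \<gamma>\<Omega> in auto)
  then have lam: "lam (t + 1) = lam t" for t by (simp add: vec_eq_iff)
  obtain c where c: "\<And>j. norm (c j) = 1" "\<And>j t. column j (V (t + 1)) = c j *s column j (V t)"
    using column_shift[OF k PT, of 1] dist \<gamma>(2) lam by metis
  define \<alpha> where "\<alpha> j = Arg (c j)" for j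
  have \<alpha>: "exp (\<i> * complex_of_real (\<alpha> j)) = c j" for j
    using c(1) by (simp add: \<alpha>_def flip: complex_norm_eq_1_exp_eq)
  have c0: "c j \<noteq> 0" for j using c(1)[of j] by auto
  let ?E = "\<Prod>j\<in>UNIV. c j"
  \<comment> \<open>The shift scales columns, so it is right multiplication by a diagonal matrix;
    writing \<open>0 + 1\<close> matches the form of \<open>c(2)\<close>.\<close>
  have "V (0 + 1) = V 0 ** diag (\<chi> j. c j)"
    unfolding matrix_eq_columns matrix_mult_diag by (auto simp only: c(2) vec_lambda_beta)
  then have "det (V 1) = det (V 0) * ?E"
    using det_diagonal[of "diag (\<chi> j. c j)"] by (simp add: det_mul diag_def)
  moreover have "det (V 0) \<noteq> 0" "?E \<noteq> 0"
    using invertible_V[OF k PT] c0 by (simp_all add: invertible_det_nz)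
  \<comment> \<open>Equality of the squared phases of the determinant at 0 and 1 leaves
    \<open>?E / cnj ?E = 1\<close>.\<close>
  ultimately have "?E = cnj ?E"
    using det_phase_constant[OF k PT, of 1 0] by (simp add: field_simps)
  moreover have "?E = cis (\<Sum>j\<in>UNIV. \<alpha> j)"
    by (simp add: \<alpha>[symmetric] cis_conv_exp exp_sum sum_distrib_left)
  \<comment> \<open>The unimodular number \<open>?E\<close> is only known to be real, so its sign
    stays open; hence the congruence modulo \<open>pi\<close> rather than
    \<open>2 * pi\<close>.\<close>
  ultimately have "sin (\<Sum>j\<in>UNIV. \<alpha> j) = 0"
    by (simp add: complex_eq_iff)
  then obtain m :: int where "(\<Sum>j\<in>UNIV. \<alpha> j) = of_int m * pi"
    by (auto simp: sin_zero_iff_int2)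
  then have "[(\<Sum>j\<in>UNIV. \<alpha> j) = 0] (rmod pi)"
    by (simp add: rcong_mult_of_int_0_left_right)
  then show ?thesis by (intro exI[of _ \<alpha>]) (simp add: lam_j c(2) \<alpha>)
qed

end
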